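(* Let $G$ be a finite group, $d\ge 2$, and fix a free continuous $G$-action on $\mathbb S^{d-1}$; equip $\mathbb R^d$ with its radial extension $g(tx)=t\,(gx)$ ($t\ge 0$, $x\in\mathbb S^{d-1}$), a semifree action with unique fixed point $0$. Let $X$ be a space and $j:\mathbb S^{d-1}\to X$ a continuous map such that, identifying $H^{d-1}(\mathbb S^{d-1};\mathbb Z)=\mathbb Z$, the image of $j^*:H^{d-1}(X;\mathbb Z)\to H^{d-1}(\mathbb S^{d-1};\mathbb Z)$ contains no integer $k$ with $k\equiv 1\pmod{|G|}$. If $f:X\to\mathbb R^d$ is continuous and $f\circ j:\mathbb S^{d-1}\to\mathbb R^d$ is $G$-equivariant, then $0\in f(X)$.
   Context: Cohomology is singular (or Čech) cohomology with integer coefficients. *)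

theory Defs
  imports "HOL-Analysis.Analysis" "HOL-Algebra.Group_Action"
begin

text \<open>Standard simplices, faces and singular simplices, following HOL-Homology.\<close>

definition std_simplex :: "nat \<Rightarrow> (nat \<Rightarrow> real) set" where
  "std_simplex p \<equiv>
    {x. (\<forall>i. 0 \<le> x i \<and> x i \<le> 1) \<and> (\<forall>i>p. x i = 0) \<and> (\<Sum>i\<le>p. x i) = 1}"

definition simp_face :: "nat \<Rightarrow> (nat \<Rightarrow> real) \<Rightarrow> nat \<Rightarrow> real" where
  "simp_face k x \<equiv> \<lambda>i. if i < k then x i else if i = k then 0 else x (i - 1)"

definition sing_simplex :: "nat \<Rightarrow> 'a topology \<Rightarrow> ((nat \<Rightarrow> real) \<Rightarrow> 'a) \<Rightarrow> bool" where
  "sing_simplex p X f \<equiv>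
      continuous_map (subtopology (powertop_real UNIV) (std_simplex p)) X f
    \<and> f \<in> extensional (std_simplex p)"

definition sing_face :: "nat \<Rightarrow> nat \<Rightarrow> ((nat \<Rightarrow> real) \<Rightarrow> 'a) \<Rightarrow> (nat \<Rightarrow> real) \<Rightarrow> 'a" where
  "sing_face p k f \<equiv> restrict (f \<circ> simp_face k) (std_simplex (p - Suc 0))"

text \<open>A p-cochain is a function from singular p-simplices to the integers (values on
  non-simplices are irrelevant). Coboundary of a p-cochain evaluated on a (p+1)-simplex:\<close>

definition cobdry :: "nat \<Rightarrow> (((nat \<Rightarrow> real) \<Rightarrow> 'a) \<Rightarrow> int) \<Rightarrow> ((nat \<Rightarrow> real) \<Rightarrow> 'a) \<Rightarrow> int" where
  "cobdry p \<phi> \<sigma> = (\<Sum>k\<le>Suc p. (-1) ^ k * \<phi> (sing_face (Suc p) k \<sigma>))"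

definition cocycle :: "nat \<Rightarrow> 'a topology \<Rightarrow> (((nat \<Rightarrow> real) \<Rightarrow> 'a) \<Rightarrow> int) \<Rightarrow> bool" where
  "cocycle p X \<phi> \<longleftrightarrow> (\<forall>\<sigma>. sing_simplex (Suc p) X \<sigma> \<longrightarrow> cobdry p \<phi> \<sigma> = 0)"

definition cohomologous :: "nat \<Rightarrow> 'a topology \<Rightarrow> (((nat \<Rightarrow> real) \<Rightarrow> 'a) \<Rightarrow> int)
    \<Rightarrow> (((nat \<Rightarrow> real) \<Rightarrow> 'a) \<Rightarrow> int) \<Rightarrow> bool" where
  "cohomologous p X \<phi> \<psi> \<longleftrightarrow>
     (case p of
        0 \<Rightarrow> (\<forall>\<sigma>. sing_simplex 0 X \<sigma> \<longrightarrow> \<phi> \<sigma> = \<psi> \<sigma>)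
      | Suc q \<Rightarrow> (\<exists>\<beta>. \<forall>\<sigma>. sing_simplex p X \<sigma> \<longrightarrow> \<phi> \<sigma> - \<psi> \<sigma> = cobdry q \<beta> \<sigma>))"

definition pullback :: "nat \<Rightarrow> ('b \<Rightarrow> 'a) \<Rightarrow> (((nat \<Rightarrow> real) \<Rightarrow> 'a) \<Rightarrow> int)
    \<Rightarrow> ((nat \<Rightarrow> real) \<Rightarrow> 'b) \<Rightarrow> int" where
  "pullback p g \<phi> = (\<lambda>\<sigma>. \<phi> (restrict (g \<circ> \<sigma>) (std_simplex p)))"

text \<open>u is a cocycle whose class generates H^p(X;Z) (every class is an integer multiple).
  Such a u fixes an identification H^p(X;Z) = Z when this group is infinite cyclic.\<close>

definition cohom_generator :: "nat \<Rightarrow> 'a topology \<Rightarrow> (((nat \<Rightarrow> real) \<Rightarrow> 'a) \<Rightarrow> int) \<Rightarrow> bool" where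
  "cohom_generator p X u \<longleftrightarrow> cocycle p X u \<and>
     (\<forall>w. cocycle p X w \<longrightarrow> (\<exists>m::int. cohomologous p X w (\<lambda>\<sigma>. m * u \<sigma>)))"

definition radial_ext :: "('g \<Rightarrow> 'e \<Rightarrow> 'e) \<Rightarrow> 'g \<Rightarrow> 'e::real_normed_vector \<Rightarrow> 'e" where
  "radial_ext \<phi> g y = (if y = 0 then 0 else norm y *\<^sub>R \<phi> g (y /\<^sub>R norm y))"

end

theory Submission
  imports Defs "HOL-Homology.Simplices"
begin

text \<open>If \<open>f\<close> had no zero, then \<open>F = (f / |f|) \<circ> j\<close> would be an equivariant self-map of the sphere
  factoring through \<open>X\<close>, so it suffices that \<open>F\<close> pulls \<open>u\<close> back to a multiple \<open>k u\<close> with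
  \<open>k \<equiv> 1\<close> modulo the order of \<open>G\<close>. To see this, deform the identity into \<open>F\<close> through equivariant maps,
  each step changing the map only on the disjoint translates of one small closed set; the
  required extensions exist because maps from closed subsets of an \<open>n\<close>-dimensional set into the
  \<open>n\<close>-sphere extend. A step is the sum of the changes on the single translates. These are conjugate
  to each other, and conjugation acts trivially on self-maps of a cyclic cohomology group, so each step
  changes the pullback of \<open>u\<close> by a multiple of \<open>|G| u\<close>. No homotopy invariance and no computation of the
  cohomology of the sphere is needed.\<close>

section \<open>Agreement of the given simplex notions with those of singular homology\<close>

lemma std_simplex_eq: "std_simplex = standard_simplex"
  by (simp add: fun_eq_iff std_simplex_def standard_simplex_def)

lemma simp_face_eq: "simp_face = simplical_face"
  by (simp add: fun_eq_iff simp_face_def simplical_face_def)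

lemma sing_simplex_eq: "sing_simplex = singular_simplex"
  by (simp add: fun_eq_iff sing_simplex_def singular_simplex_def std_simplex_eq)

lemma sing_face_eq: "sing_face = singular_face"
  by (simp add: fun_eq_iff sing_face_def singular_face_def std_simplex_eq simp_face_eq)

lemma pullback_eq: "pullback p g \<phi> = \<phi> \<circ> simplex_map p g"
  by (simp add: fun_eq_iff pullback_def simplex_map_def std_simplex_eq)

subsection \<open>Cochains\<close>

lemma cohomologous_Suc:
  "cohomologous (Suc q) X \<phi> \<psi> \<longleftrightarrow>
     (\<exists>\<beta>. \<forall>\<sigma>. singular_simplex (Suc q) X \<sigma> \<longrightarrow> \<phi> \<sigma> - \<psi> \<sigma> = cobdry q \<beta> \<sigma>)"
  by (simp add: cohomologous_def sing_simplex_eq)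

lemma cobdry_add: "cobdry p (\<lambda>\<tau>. \<beta> \<tau> + \<gamma> \<tau>) \<sigma> = cobdry p \<beta> \<sigma> + cobdry p \<gamma> \<sigma>"
  by (simp add: cobdry_def algebra_simps sum.distrib)

lemma cobdry_cmult: "cobdry p (\<lambda>\<tau>. a * \<beta> \<tau>) \<sigma> = a * cobdry p \<beta> \<sigma>"
  by (simp add: cobdry_def sum_distrib_left mult.left_commute del: sum.atMost_Suc)

lemma cobdry_diff: "cobdry p (\<lambda>\<tau>. \<beta> \<tau> - \<gamma> \<tau>) \<sigma> = cobdry p \<beta> \<sigma> - cobdry p \<gamma> \<sigma>"
  using cobdry_add[of p \<beta> "\<lambda>\<tau>. -1 * \<gamma> \<tau>" \<sigma>] cobdry_cmult[of p "-1" \<gamma> \<sigma>] by simp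

lemma cobdry_sum: "cobdry p (\<lambda>\<tau>. \<Sum>i\<in>I. \<beta> i \<tau>) \<sigma> = (\<Sum>i\<in>I. cobdry p (\<beta> i) \<sigma>)"
proof (induction I rule: infinite_finite_induct)
  case (insert i I)
  then show ?case by (simp add: cobdry_add)
qed (simp_all add: cobdry_def)

lemma cohomologous_refl: "cohomologous (Suc q) X \<phi> \<phi>"
  unfolding cohomologous_Suc by (rule exI[of _ "\<lambda>_. 0"]) (simp add: cobdry_def)

lemma cohomologous_add:
  assumes "cohomologous (Suc q) X \<phi> \<psi>" "cohomologous (Suc q) X \<phi>' \<psi>'"
  shows "cohomologous (Suc q) X (\<lambda>\<sigma>. \<phi> \<sigma> + \<phi>' \<sigma>) (\<lambda>\<sigma>. \<psi> \<sigma> + \<psi>' \<sigma>)"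
proof -
  from assms obtain \<beta> \<gamma> where
    *: "\<And>\<sigma>. singular_simplex (Suc q) X \<sigma> \<Longrightarrow> \<phi> \<sigma> - \<psi> \<sigma> = cobdry q \<beta> \<sigma>"
    "\<And>\<sigma>. singular_simplex (Suc q) X \<sigma> \<Longrightarrow> \<phi>' \<sigma> - \<psi>' \<sigma> = cobdry q \<gamma> \<sigma>"
    unfolding cohomologous_Suc by metis
  then show ?thesis
    unfolding cohomologous_Suc
    by (intro exI[of _ "\<lambda>\<tau>. \<beta> \<tau> + \<gamma> \<tau>"]) (force simp: cobdry_add)
qed

lemma cohomologous_cmult:
  assumes "cohomologous (Suc q) X \<phi> \<psi>"
  shows "cohomologous (Suc q) X (\<lambda>\<sigma>. a * \<phi> \<sigma>) (\<lambda>\<sigma>. a * \<psi> \<sigma>)"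
proof -
  from assms obtain \<beta> where
    "\<And>\<sigma>. singular_simplex (Suc q) X \<sigma> \<Longrightarrow> \<phi> \<sigma> - \<psi> \<sigma> = cobdry q \<beta> \<sigma>"
    unfolding cohomologous_Suc by metis
  then show ?thesis
    unfolding cohomologous_Suc
    by (intro exI[of _ "\<lambda>\<tau>. a * \<beta> \<tau>"]) (metis cobdry_cmult right_diff_distrib)
qed

text \<open>Reduces symmetry and transitivity to linearity: both become statements about multiples
  and sums of coboundaries.\<close>

lemma cohomologous_iff_diff:
  "cohomologous (Suc q) X \<phi> \<psi> \<longleftrightarrow> cohomologous (Suc q) X (\<lambda>\<sigma>. \<phi> \<sigma> - \<psi> \<sigma>) (\<lambda>_. 0)"
  by (simp add: cohomologous_Suc)

lemma cohomologous_sym: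
  "cohomologous (Suc q) X \<phi> \<psi> \<Longrightarrow> cohomologous (Suc q) X \<psi> \<phi>"
  using cohomologous_cmult[of q X "\<lambda>\<sigma>. \<phi> \<sigma> - \<psi> \<sigma>" "\<lambda>_. 0" "-1"]
  by (simp add: cohomologous_iff_diff[of q X \<phi>] cohomologous_iff_diff[of q X \<psi>])

lemma cohomologous_trans:
  "\<lbrakk>cohomologous (Suc q) X \<phi> \<psi>; cohomologous (Suc q) X \<psi> \<theta>\<rbrakk> \<Longrightarrow> cohomologous (Suc q) X \<phi> \<theta>"
  using cohomologous_add[of q X "\<lambda>\<sigma>. \<phi> \<sigma> - \<psi> \<sigma>" "\<lambda>_. 0" "\<lambda>\<sigma>. \<psi> \<sigma> - \<theta> \<sigma>" "\<lambda>_. 0"]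
  by (simp add: cohomologous_iff_diff[of q X \<phi>] cohomologous_iff_diff[of q X \<psi>])

lemma cohomologous_diff:
  assumes "cohomologous (Suc q) X \<phi> \<psi>" "cohomologous (Suc q) X \<phi>' \<psi>'"
  shows "cohomologous (Suc q) X (\<lambda>\<sigma>. \<phi> \<sigma> - \<phi>' \<sigma>) (\<lambda>\<sigma>. \<psi> \<sigma> - \<psi>' \<sigma>)"
  using cohomologous_add[OF assms(1) cohomologous_cmult[OF assms(2), of "-1"]] by simp

lemma cohomologous_sum:
  assumes "\<And>i. i \<in> I \<Longrightarrow> cohomologous (Suc q) X (\<phi> i) (\<psi> i)"
  shows "cohomologous (Suc q) X (\<lambda>\<sigma>. \<Sum>i\<in>I. \<phi> i \<sigma>) (\<lambda>\<sigma>. \<Sum>i\<in>I. \<psi> i \<sigma>)"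
  using assms
  by (induction I rule: infinite_finite_induct)
     (simp_all add: cohomologous_refl cohomologous_add)

section \<open>Pullback of cochains along maps\<close>

lemma singular_face_simplex_map_commute:
  assumes "k \<le> Suc p"
  shows "singular_face (Suc p) k (simplex_map (Suc p) g \<sigma>) = simplex_map p g (singular_face (Suc p) k \<sigma>)"
  using assms
  by (simp add: singular_face_simplex_map) (auto simp: simplex_map_def singular_face_def)

lemma cobdry_pullback:
  "cobdry p (pullback p g \<phi>) \<sigma> = cobdry p \<phi> (simplex_map (Suc p) g \<sigma>)"
  unfolding cobdry_def sing_face_eq pullback_eq
  by (rule sum.cong) (simp_all add: singular_face_simplex_map_commute)

lemma cocycle_pullback:
  assumes "cocycle p X \<phi>" "continuous_map Y X g"
  shows "cocycle p Y (pullback p g \<phi>)"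
  using assms singular_simplex_simplex_map
  unfolding cocycle_def sing_simplex_eq cobdry_pullback by blast

lemma cohomologous_pullback:
  assumes "cohomologous (Suc q) X \<phi> \<psi>" "continuous_map Y X g"
  shows "cohomologous (Suc q) Y (pullback (Suc q) g \<phi>) (pullback (Suc q) g \<psi>)"
proof -
  from assms(1) obtain \<beta> where
    \<beta>: "\<And>\<sigma>. singular_simplex (Suc q) X \<sigma> \<Longrightarrow> \<phi> \<sigma> - \<psi> \<sigma> = cobdry q \<beta> \<sigma>"
    unfolding cohomologous_Suc by metis
  show ?thesis
    unfolding cohomologous_Suc
  proof (intro exI[of _ "pullback q g \<beta>"] allI impI)
    fix \<sigma> assume "singular_simplex (Suc q) Y \<sigma>"
    then show "pullback (Suc q) g \<phi> \<sigma> - pullback (Suc q) g \<psi> \<sigma> = cobdry q (pullback q g \<beta>) \<sigma>"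
      using \<beta>[OF singular_simplex_simplex_map[OF _ assms(2)]]
      unfolding cobdry_pullback by (simp add: pullback_eq)
  qed
qed

lemma pullback_cmult: "pullback p g (\<lambda>\<sigma>. k * \<phi> \<sigma>) = (\<lambda>\<sigma>. k * pullback p g \<phi> \<sigma>)"
  by (simp add: pullback_def)

lemma pullback_comp: "pullback p h (pullback p g \<phi>) = pullback p (g \<circ> h) \<phi>"
  by (simp add: pullback_eq simplex_map_compose comp_assoc)

text \<open>A simplex inside \<open>U\<close> sees a map only through its values on
  \<open>U\<close>. This locality is what makes differences of pullbacks vanish on small
  simplices.\<close>

lemma pullback_cong:
  assumes "singular_simplex p (subtopology X U) \<sigma>" "\<And>x. x \<in> topspace X \<Longrightarrow> x \<in> U \<Longrightarrow> g x = h x"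
  shows "pullback p g \<phi> \<sigma> = pullback p h \<phi> \<sigma>"
  using simplex_map_eq[OF assms(1), of g h] assms(2) by (simp add: pullback_eq)

lemma cohomologous_pullback_cong:
  assumes "\<And>x. x \<in> topspace X \<Longrightarrow> g x = h x"
  shows "cohomologous (Suc q) X (pullback (Suc q) g \<phi>) (pullback (Suc q) h \<phi>)"
  unfolding cohomologous_Suc
  using pullback_cong[of "Suc q" X UNIV _ g h \<phi>] assms
  by (intro exI[of _ "\<lambda>_. 0"]) (simp add: cobdry_def)

lemma cohomologous_pullback_id:
  assumes "\<And>x. x \<in> topspace X \<Longrightarrow> g x = x"
  shows "cohomologous (Suc q) X (pullback (Suc q) g \<phi>) \<phi>"
  unfolding cohomologous_Suc pullback_eq
  using simplex_map_id_gen[of "Suc q" X _ g] assms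
  by (intro exI[of _ "\<lambda>_. 0"]) (simp add: cobdry_def)

lemma cocycle_diff:
  "\<lbrakk>cocycle p X \<phi>; cocycle p X \<psi>\<rbrakk> \<Longrightarrow> cocycle p X (\<lambda>\<sigma>. \<phi> \<sigma> - \<psi> \<sigma>)"
  by (simp add: cocycle_def cobdry_diff)

lemma cocycle_sum:
  "(\<And>i. i \<in> I \<Longrightarrow> cocycle p X (\<phi> i)) \<Longrightarrow> cocycle p X (\<lambda>\<sigma>. \<Sum>i\<in>I. \<phi> i \<sigma>)"
  by (simp add: cocycle_def cobdry_sum)

subsection \<open>Cocycles vanishing on small simplices\<close>

text \<open>Linearity is inherited from the extension to chains over the free abelian group on one point.\<close>

definition cochain_eval :: "(((nat \<Rightarrow> real) \<Rightarrow> 'a) \<Rightarrow> int) \<Rightarrow> 'a chain \<Rightarrow> int" where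
  "cochain_eval \<phi> c = Poly_Mapping.lookup (frag_extend (\<lambda>\<sigma>. frag_cmul (\<phi> \<sigma>) (frag_of ())) c) ()"

lemma cochain_eval_0 [simp]: "cochain_eval \<phi> 0 = 0"
  by (simp add: cochain_eval_def)

lemma cochain_eval_of [simp]: "cochain_eval \<phi> (frag_of \<sigma>) = \<phi> \<sigma>"
  by (simp add: cochain_eval_def)

lemma cochain_eval_diff: "cochain_eval \<phi> (a - b) = cochain_eval \<phi> a - cochain_eval \<phi> b"
  by (simp add: cochain_eval_def frag_extend_diff lookup_minus)

lemma cochain_eval_add: "cochain_eval \<phi> (a + b) = cochain_eval \<phi> a + cochain_eval \<phi> b"
  by (simp add: cochain_eval_def frag_extend_add lookup_add)

lemma cochain_eval_cmul: "cochain_eval \<phi> (frag_cmul k a) = k * cochain_eval \<phi> a"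
  by (simp add: cochain_eval_def frag_extend_cmul)

lemma cochain_eval_sum: "cochain_eval \<phi> (\<Sum>i\<in>I. c i) = (\<Sum>i\<in>I. cochain_eval \<phi> (c i))"
  by (induction I rule: infinite_finite_induct) (simp_all add: cochain_eval_add)

lemma cochain_eval_eq_0:
  assumes "\<And>\<sigma>. \<sigma> \<in> Poly_Mapping.keys c \<Longrightarrow> \<phi> \<sigma> = 0"
  shows "cochain_eval \<phi> c = 0"
  unfolding cochain_eval_def by (subst frag_extend_eq_0) (simp_all add: assms)

text \<open>Chains are freely generated by simplices, so an additive functional is determined by its
  values there. Functionals built from chain operators can thus be treated as cochains.\<close>

lemma additive_eq_cochain_eval:
  fixes L :: "'a chain \<Rightarrow> int"
  assumes L0: "L 0 = 0" and L: "\<And>a b. L (a - b) = L a - L b"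
  shows "L c = cochain_eval (\<lambda>\<sigma>. L (frag_of \<sigma>)) c"
  by (rule frag_induction[OF subset_UNIV]) (simp_all add: L0 L cochain_eval_diff)

lemma cochain_eval_boundary_of:
  "cochain_eval \<phi> (chain_boundary (Suc p) (frag_of \<sigma>)) = cobdry p \<phi> \<sigma>"
  by (simp add: chain_boundary_of cobdry_def sing_face_eq cochain_eval_sum cochain_eval_cmul
        del: sum.atMost_Suc)

lemma cochain_eval_boundary:
  assumes "cocycle p X \<phi>" "singular_chain (Suc p) X c"
  shows "cochain_eval \<phi> (chain_boundary (Suc p) c) = 0"
  using assms(2) unfolding singular_chain_def
proof (induction c rule: frag_induction)
  case (one \<sigma>)
  then show ?case
    using assms(1) by (simp add: cochain_eval_boundary_of cocycle_def sing_simplex_eq)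
qed (simp_all add: chain_boundary_diff cochain_eval_diff)

lemma singular_subdivision_power_chain:
  "singular_chain p X c \<Longrightarrow> singular_chain p X ((singular_subdivision p ^^ i) c)"
  by (induction i) (simp_all add: singular_chain_singular_subdivision)

lemma chain_boundary_subdivision_power:
  assumes "singular_chain p X c"
  shows "chain_boundary p ((singular_subdivision p ^^ i) c) =
         (singular_subdivision (p - Suc 0) ^^ i) (chain_boundary p c)"
  by (induction i)
     (use assms in \<open>simp_all add: chain_boundary_singular_subdivision[OF singular_subdivision_power_chain]\<close>)

text \<open>With the subdivision operator \<open>S\<close> and the natural chain homotopy \<open>h\<close> from \<open>S\<close> to the
  identity, a primitive is \<open>- (\<Sum>i. \<delta> \<circ> h \<circ> S\<^sup>i)\<close>: by naturality of \<open>h\<close> the terms of the sum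
  vanish on a given simplex as soon as its \<open>i\<close>-th subdivision is small.\<close>

lemma cocycle_vanishing_on_small_simplices:
  assumes \<delta>: "cocycle (Suc q) X \<delta>"
    and op: "\<And>U. U \<in> \<C> \<Longrightarrow> openin X U" and cov: "topspace X \<subseteq> \<Union>\<C>"
    and small: "\<And>U \<sigma>. \<lbrakk>U \<in> \<C>; singular_simplex (Suc q) (subtopology X U) \<sigma>\<rbrakk> \<Longrightarrow> \<delta> \<sigma> = 0"
  shows "cohomologous (Suc q) X \<delta> (\<lambda>_. 0)"
proof -
  \<comment> \<open>\<open>h\<close> is one operator for all topologies on the type, so
    \<open>hchain\<close> may be used in \<open>subtopology X V\<close>: a chain in \<open>V\<close>
    has its image under \<open>h\<close> in \<open>V\<close>. This is the naturality that is
    needed.\<close>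
  obtain h where h0: "\<And>p. h p 0 = (0 :: 'a chain)"
    and hdiff: "\<And>p c1 c2. h p (c1 - c2) = h p c1 - h p c2"
    and hchain: "\<And>p (X :: 'a topology) c. singular_chain p X c \<Longrightarrow> singular_chain (Suc p) X (h p c)"
    and hhom: "\<And>p (X :: 'a topology) c. singular_chain p X c \<Longrightarrow>
      chain_boundary (Suc p) (h p c) + h (p - Suc 0) (chain_boundary p c) = singular_subdivision p c - c"
    by (rule chain_homotopic_singular_subdivision) blast
  define S where "S = (\<lambda>p i. (singular_subdivision p ^^ i) :: 'a chain \<Rightarrow> 'a chain)"
  have S_diff: "S p i (a - b) = S p i a - S p i b" and S_0: "S p i 0 = 0" for p i a b
    by (simp_all add: S_def singular_subdivision_power_diff)
  have eval_small: "cochain_eval \<delta> c = 0"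
    if ch: "singular_chain (Suc q) X c"
      and ex: "\<And>\<sigma>. \<sigma> \<in> Poly_Mapping.keys c \<Longrightarrow> \<exists>V\<in>\<C>. \<sigma> \<in> standard_simplex (Suc q) \<rightarrow> V" for c
  proof (rule cochain_eval_eq_0)
    fix \<sigma> assume \<sigma>: "\<sigma> \<in> Poly_Mapping.keys c"
    then obtain V where "V \<in> \<C>" "\<sigma> \<in> standard_simplex (Suc q) \<rightarrow> V" using ex by blast
    moreover have "singular_simplex (Suc q) X \<sigma>" using ch \<sigma> by (auto simp: singular_chain_def)
    ultimately show "\<delta> \<sigma> = 0"
      by (intro small[of V]) (auto simp: singular_simplex_subtopology)
  qed
  have h_small: "cochain_eval \<delta> (h q c) = 0"
    if "Poly_Mapping.keys c \<subseteq> {\<sigma>. \<exists>V\<in>\<C>. singular_simplex q (subtopology X V) \<sigma>}" for c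
    using that
  proof (induction c rule: frag_induction)
    case (one \<sigma>)
    then obtain V where V: "V \<in> \<C>" "singular_chain q (subtopology X V) (frag_of \<sigma>)"
      by (auto simp: singular_chain_of)
    show ?case
    proof (rule cochain_eval_eq_0)
      fix \<tau> assume "\<tau> \<in> Poly_Mapping.keys (h q (frag_of \<sigma>))"
      then show "\<delta> \<tau> = 0"
        using hchain[OF V(2)] V(1) small by (auto simp: singular_chain_def)
    qed
  qed (simp_all add: h0 hdiff cochain_eval_diff)
  define L where "L = (\<lambda>m c. \<Sum>i<m. cochain_eval \<delta> (h q (S q i c)))"
  have L_0: "L m 0 = 0" and L_diff: "L m (a - b) = L m a - L m b" for m a b
    by (simp_all add: L_def S_0 S_diff h0 hdiff cochain_eval_diff sum_subtractf)
  \<comment> \<open>On a fixed simplex the infinite sum is finite: once its iterated subdivisions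
    are small, \<open>h_small\<close> kills every further term. The bound \<open>N\<close> depends
    on the simplex.\<close>
  have "\<exists>N. \<forall>m\<ge>N. L m (frag_of \<tau>) = L N (frag_of \<tau>)" if \<tau>: "singular_simplex q X \<tau>" for \<tau>
  proof -
    have ch: "singular_chain q X (frag_of \<tau>)" using \<tau> by (simp add: singular_chain_of)
    obtain N where N: "\<And>m f. \<lbrakk>N \<le> m; f \<in> Poly_Mapping.keys (S q m (frag_of \<tau>))\<rbrakk>
                      \<Longrightarrow> \<exists>V \<in> \<C>. f \<in> standard_simplex q \<rightarrow> V"
      using sufficient_iterated_singular_subdivision_exists[OF op cov ch] unfolding S_def by metis
    have z: "cochain_eval \<delta> (h q (S q i (frag_of \<tau>))) = 0" if "N \<le> i" for i
    proof (rule h_small, clarify)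
      fix f assume f: "f \<in> Poly_Mapping.keys (S q i (frag_of \<tau>))"
      then have "singular_simplex q X f"
        using singular_subdivision_power_chain[OF ch, of i] by (auto simp: S_def singular_chain_def)
      then show "\<exists>V\<in>\<C>. singular_simplex q (subtopology X V) f"
        using N[OF that f] by (auto simp: singular_simplex_subtopology image_subset_iff Pi_iff)
    qed
    show ?thesis
    proof (intro exI allI impI)
      fix m assume "N \<le> m"
      then show "L m (frag_of \<tau>) = L N (frag_of \<tau>)"
        unfolding L_def by (intro sum.mono_neutral_right) (auto intro: z)
    qed
  qed
  then obtain N where N: "\<And>\<tau> m. \<lbrakk>singular_simplex q X \<tau>; N \<tau> \<le> m\<rbrakk> \<Longrightarrow>
      L m (frag_of \<tau>) = L (N \<tau>) (frag_of \<tau>)"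
    by metis
  define \<beta> where "\<beta> = (\<lambda>\<tau>. - L (N \<tau>) (frag_of \<tau>))"
  have "\<delta> \<sigma> = cobdry q \<beta> \<sigma>" if \<sigma>: "singular_simplex (Suc q) X \<sigma>" for \<sigma>
  proof -
    have ch: "singular_chain (Suc q) X (frag_of \<sigma>)" using \<sigma> by (simp add: singular_chain_of)
    have chS: "singular_chain (Suc q) X (S (Suc q) i (frag_of \<sigma>))" for i
      unfolding S_def by (rule singular_subdivision_power_chain[OF ch])
    obtain M where M: "\<And>m f. \<lbrakk>M \<le> m; f \<in> Poly_Mapping.keys (S (Suc q) m (frag_of \<sigma>))\<rbrakk>
                      \<Longrightarrow> \<exists>V \<in> \<C>. f \<in> standard_simplex (Suc q) \<rightarrow> V"
      using sufficient_iterated_singular_subdivision_exists[OF op cov ch] unfolding S_def by metis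
    \<comment> \<open>From \<open>m\<close> on everything needed for \<open>\<sigma>\<close> is
      settled: its subdivision is small, and \<open>L\<close> has reached its final value on each of
      the finitely many faces.\<close>
    define m where "m = max M (Max ((\<lambda>k. N (singular_face (Suc q) k \<sigma>)) ` {..Suc q}))"
    have Nm: "N (singular_face (Suc q) k \<sigma>) \<le> m" if "k \<le> Suc q" for k
      unfolding m_def by (rule max.coboundedI2, rule Max_ge) (use that in auto)
    \<comment> \<open>This is the homotopy formula \<open>hhom\<close> on the \<open>i\<close>-th
      subdivision: \<delta> vanishes on the boundary term because it is a cocycle, and subdivision
      commutes with the boundary.\<close>
    have step: "cochain_eval \<delta> (S (Suc q) (Suc i) (frag_of \<sigma>)) - cochain_eval \<delta> (S (Suc q) i (frag_of \<sigma>))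
        = cochain_eval \<delta> (h q (S q i (chain_boundary (Suc q) (frag_of \<sigma>))))" for i
    proof -
      have "cochain_eval \<delta> (S (Suc q) (Suc i) (frag_of \<sigma>)) - cochain_eval \<delta> (S (Suc q) i (frag_of \<sigma>))
          = cochain_eval \<delta> (singular_subdivision (Suc q) (S (Suc q) i (frag_of \<sigma>)) - S (Suc q) i (frag_of \<sigma>))"
        by (simp add: S_def cochain_eval_diff)
      also have "\<dots> = cochain_eval \<delta> (chain_boundary (Suc (Suc q)) (h (Suc q) (S (Suc q) i (frag_of \<sigma>))))
          + cochain_eval \<delta> (h q (chain_boundary (Suc q) (S (Suc q) i (frag_of \<sigma>))))"
        using hhom[OF chS[of i]] by (simp flip: cochain_eval_add)
      also have "chain_boundary (Suc q) (S (Suc q) i (frag_of \<sigma>)) = S q i (chain_boundary (Suc q) (frag_of \<sigma>))"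
        using chain_boundary_subdivision_power[OF ch] by (simp add: S_def)
      finally show ?thesis
        using cochain_eval_boundary[OF \<delta> hchain[OF chS]] by simp
    qed
    \<comment> \<open>Summing \<open>step\<close> over \<open>i < m\<close> telescopes, leaving only
      the zeroth and the \<open>m\<close>-th subdivision.\<close>
    have "\<delta> \<sigma> = cochain_eval \<delta> (S (Suc q) m (frag_of \<sigma>)) - L m (chain_boundary (Suc q) (frag_of \<sigma>))"
    proof -
      have "L m (chain_boundary (Suc q) (frag_of \<sigma>)) =
        (\<Sum>i<m. cochain_eval \<delta> (S (Suc q) (Suc i) (frag_of \<sigma>)) - cochain_eval \<delta> (S (Suc q) i (frag_of \<sigma>)))"
        by (simp only: step L_def)
      also have "\<dots> = cochain_eval \<delta> (S (Suc q) m (frag_of \<sigma>)) - cochain_eval \<delta> (S (Suc q) 0 (frag_of \<sigma>))"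
        by (rule sum_lessThan_telescope)
      finally show ?thesis by (simp add: S_def)
    qed
    also have "cochain_eval \<delta> (S (Suc q) m (frag_of \<sigma>)) = 0"
      by (rule eval_small[OF chS M]) (auto simp: m_def)
    \<comment> \<open>Being additive, \<open>L m\<close> evaluated on the boundary of
      \<open>\<sigma>\<close> is the coboundary of its restriction to simplices.\<close>
    also have "L m (chain_boundary (Suc q) (frag_of \<sigma>)) = cobdry q (\<lambda>\<tau>. L m (frag_of \<tau>)) \<sigma>"
      by (subst additive_eq_cochain_eval[of "L m"]) (simp_all add: L_0 L_diff cochain_eval_boundary_of)
    also have "\<dots> = cobdry q (\<lambda>\<tau>. - 1 * \<beta> \<tau>) \<sigma>"
      unfolding cobdry_def sing_face_eq
    proof (rule sum.cong)
      fix k assume "k \<in> {..Suc q}"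
      then have "singular_simplex q X (singular_face (Suc q) k \<sigma>)" "k \<le> Suc q"
        using singular_simplex_singular_face[OF \<sigma>, of k] by auto
      then show "(- 1) ^ k * L m (frag_of (singular_face (Suc q) k \<sigma>)) =
            (- 1) ^ k * (- 1 * \<beta> (singular_face (Suc q) k \<sigma>))"
        using N[OF _ Nm] by (simp add: \<beta>_def)
    qed simp
    finally show ?thesis unfolding cobdry_cmult by simp
  qed
  then show ?thesis by (auto simp: cohomologous_Suc)
qed

subsection \<open>Equivariant self-maps\<close>

text \<open>The multiplier \<open>k\<close> plays the role of a degree. It is not claimed to be
  unique, so later arguments never cancel or compare multipliers, only classes.\<close>

lemma generator_pullback:
  assumes "cohom_generator p X u" "continuous_map X X g"
  obtains k where "cohomologous p X (pullback p g u) (\<lambda>\<sigma>. k * u \<sigma>)"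
  using assms cocycle_pullback unfolding cohom_generator_def by blast

lemma pullback_comp_multiple:
  assumes "continuous_map X X g" "cohomologous (Suc q) X (pullback (Suc q) f u) (\<lambda>\<sigma>. k * u \<sigma>)"
    "cohomologous (Suc q) X (pullback (Suc q) g u) (\<lambda>\<sigma>. l * u \<sigma>)"
  shows "cohomologous (Suc q) X (pullback (Suc q) (f \<circ> g) u) (\<lambda>\<sigma>. k * l * u \<sigma>)"
  using cohomologous_trans[OF cohomologous_pullback[OF assms(2,1)]] cohomologous_cmult[OF assms(3), of k]
  by (simp add: pullback_comp pullback_cmult mult.assoc)

text \<open>With multipliers \<alpha>, \<beta>, \<gamma> of \<open>a\<close>, \<open>b\<close>,
  \<open>f\<close>, the conjugate has multiplier \<alpha>\<gamma>\<beta> =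
  (\<alpha>\<beta>)\<gamma>, and \<alpha>\<beta> acts as 1 on \<open>u\<close> because
  \<open>a \<circ> b\<close> is the identity.\<close>

lemma pullback_conjugate:
  assumes u: "cohom_generator (Suc q) X u"
    and cont: "continuous_map X X a" "continuous_map X X b" "continuous_map X X f"
    and ab: "\<And>x. x \<in> topspace X \<Longrightarrow> a (b x) = x"
  shows "cohomologous (Suc q) X (pullback (Suc q) (a \<circ> f \<circ> b) u) (pullback (Suc q) f u)"
proof -
  obtain \<alpha> where \<alpha>: "cohomologous (Suc q) X (pullback (Suc q) a u) (\<lambda>\<sigma>. \<alpha> * u \<sigma>)"
    using generator_pullback[OF u cont(1)] .
  obtain \<beta> where \<beta>: "cohomologous (Suc q) X (pullback (Suc q) b u) (\<lambda>\<sigma>. \<beta> * u \<sigma>)"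
    using generator_pullback[OF u cont(2)] .
  obtain \<gamma> where \<gamma>: "cohomologous (Suc q) X (pullback (Suc q) f u) (\<lambda>\<sigma>. \<gamma> * u \<sigma>)"
    using generator_pullback[OF u cont(3)] .
  have "cohomologous (Suc q) X (pullback (Suc q) (a \<circ> b) u) u"
    by (rule cohomologous_pullback_id) (simp add: ab)
  then have "cohomologous (Suc q) X (\<lambda>\<sigma>. \<alpha> * \<beta> * u \<sigma>) u"
    using pullback_comp_multiple[OF cont(2) \<alpha> \<beta>] cohomologous_sym cohomologous_trans by blast
  \<comment> \<open>That \<alpha>\<beta> acts as 1 is known only up to coboundaries, so the relation
    itself is multiplied by \<gamma> instead of replacing \<alpha>\<beta> by 1.\<close>
  from cohomologous_cmult[OF this, of \<gamma>]
  have "cohomologous (Suc q) X (\<lambda>\<sigma>. \<alpha> * \<gamma> * \<beta> * u \<sigma>) (\<lambda>\<sigma>. \<gamma> * u \<sigma>)"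
    by (simp add: mult_ac)
  then show ?thesis
    using pullback_comp_multiple[OF cont(2) pullback_comp_multiple[OF cont(3) \<alpha> \<gamma>] \<beta>]
      cohomologous_sym[OF \<gamma>] cohomologous_trans by blast
qed

section \<open>Continuous actions of a finite group and translates of sets\<close>

locale finite_continuous_action = group_action G "topspace X" \<phi>
  for G (structure) and X :: "'a topology" and \<phi> +
  assumes finite_carrier: "finite (carrier G)"
    and continuous_action: "g \<in> carrier G \<Longrightarrow> continuous_map X X (\<phi> g)"
begin

sublocale group G
  using group_hom group_hom.axioms(1) by auto

definition equivariant :: "('a \<Rightarrow> 'a) \<Rightarrow> bool" where
  "equivariant F \<longleftrightarrow> (\<forall>g\<in>carrier G. \<forall>x\<in>topspace X. F (\<phi> g x) = \<phi> g (F x))"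

lemma act_in [simp]: "g \<in> carrier G \<Longrightarrow> x \<in> topspace X \<Longrightarrow> \<phi> g x \<in> topspace X"
  by (rule element_image[OF _ _ refl])

lemma act_one [simp]: "x \<in> topspace X \<Longrightarrow> \<phi> \<one> x = x"
  by (subst id_eq_one[symmetric]) simp

lemma act_inv [simp]: "g \<in> carrier G \<Longrightarrow> x \<in> topspace X \<Longrightarrow> \<phi> (inv g) (\<phi> g x) = x"
  using orbit_sym_aux by blast

lemma act_inv' [simp]: "g \<in> carrier G \<Longrightarrow> x \<in> topspace X \<Longrightarrow> \<phi> g (\<phi> (inv g) x) = x"
  by (metis act_inv inv_closed inv_inv)

lemma in_translate_iff:
  "\<lbrakk>g \<in> carrier G; A \<subseteq> topspace X; x \<in> topspace X\<rbrakk> \<Longrightarrow> x \<in> \<phi> g ` A \<longleftrightarrow> \<phi> (inv g) x \<in> A"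
  by (auto simp: subset_iff intro: image_eqI[where x = "\<phi> (inv g) x"])

text \<open>A translate is the preimage under the inverse element, so continuity of the action alone
  makes translates of open sets open and of closed sets closed.\<close>

lemma translate_eq:
  "\<lbrakk>g \<in> carrier G; A \<subseteq> topspace X\<rbrakk> \<Longrightarrow> \<phi> g ` A = {x \<in> topspace X. \<phi> (inv g) x \<in> A}"
  using in_translate_iff[of g A] by (auto simp: subset_iff)

lemma openin_translate: "\<lbrakk>g \<in> carrier G; openin X V\<rbrakk> \<Longrightarrow> openin X (\<phi> g ` V)"
  using openin_continuous_map_preimage[OF continuous_action[of "inv g"], of V]
  by (simp add: translate_eq openin_subset)

lemma closedin_translate: "\<lbrakk>g \<in> carrier G; closedin X Y\<rbrakk> \<Longrightarrow> closedin X (\<phi> g ` Y)"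
  using closedin_continuous_map_preimage[OF continuous_action[of "inv g"], of Y]
  by (simp add: translate_eq closedin_subset)

text \<open>If the translates by \<open>g\<close> and \<open>h\<close> met, then so would
  \<open>A\<close> and its translate by \<open>inv h \<otimes> g\<close>.\<close>

lemma translates_unique:
  assumes "A \<subseteq> topspace X" and disj: "\<And>g. \<lbrakk>g \<in> carrier G; g \<noteq> \<one>\<rbrakk> \<Longrightarrow> \<phi> g ` A \<inter> A = {}"
    and "g \<in> carrier G" "h \<in> carrier G" "x \<in> \<phi> g ` A" "x \<in> \<phi> h ` A"
  shows "g = h"
proof (rule ccontr)
  assume "g \<noteq> h"
  then have k: "inv h \<otimes> g \<in> carrier G" "inv h \<otimes> g \<noteq> \<one>"
    using assms by (auto simp: inv_equality inv_solve_left')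
  from assms obtain y z where yz: "y \<in> A" "x = \<phi> g y" "z \<in> A" "x = \<phi> h z" by blast
  then have "\<phi> (inv h \<otimes> g) y = z"
    using assms by (metis act_inv composition_rule inv_closed subsetD)
  with disj[OF k] yz show False by blast
qed

text \<open>The change from \<open>F\<^sub>0\<close> to \<open>F\<^sub>1\<close> splits into changes \<open>P g\<close> supported in the disjoint
  sets \<open>g Y\<close>, and these are all conjugate to \<open>P \<one>\<close>.\<close>

lemma pullback_change_on_orbit:
  assumes u: "cohom_generator (Suc q) X u"
    and F0: "continuous_map X X F\<^sub>0" "equivariant F\<^sub>0"
    and F1: "continuous_map X X F\<^sub>1" "equivariant F\<^sub>1"
    and Y: "closedin X Y" and V: "openin X V" and YV: "Y \<subseteq> V"
    and disj: "\<And>g. \<lbrakk>g \<in> carrier G; g \<noteq> \<one>\<rbrakk> \<Longrightarrow> \<phi> g ` V \<inter> V = {}"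
    and eq: "\<And>x. \<lbrakk>x \<in> topspace X; \<And>g. g \<in> carrier G \<Longrightarrow> x \<notin> \<phi> g ` Y\<rbrakk> \<Longrightarrow> F\<^sub>1 x = F\<^sub>0 x"
  obtains m where "cohomologous (Suc q) X
      (\<lambda>\<sigma>. pullback (Suc q) F\<^sub>1 u \<sigma> - pullback (Suc q) F\<^sub>0 u \<sigma>) (\<lambda>\<sigma>. int (order G) * m * u \<sigma>)"
proof -
  have VX: "V \<subseteq> topspace X" and YX: "Y \<subseteq> topspace X"
    using V Y by (simp_all add: openin_subset closedin_subset)
  have cocycle_u: "cocycle (Suc q) X u" using u by (simp add: cohom_generator_def)
  have uniq: "g = h" if "g \<in> carrier G" "h \<in> carrier G" "x \<in> \<phi> g ` V" "x \<in> \<phi> h ` V" for g h x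
    using translates_unique[OF VX disj] that by blast
  define P where "P = (\<lambda>g x. if x \<in> \<phi> g ` V then F\<^sub>1 x else F\<^sub>0 x)"
  \<comment> \<open>A point of \<open>g V\<close> outside \<open>g Y\<close> lies in no other
    \<open>h Y\<close> either, since \<open>h Y\<close> is inside \<open>h V\<close>, which is
    disjoint from \<open>g V\<close>. There \<open>F\<^sub>1\<close> and \<open>F\<^sub>0\<close>
    agree by \<open>eq\<close>.\<close>
  have P_eq0: "P g x = F\<^sub>0 x" if "g \<in> carrier G" "x \<in> topspace X" "x \<notin> \<phi> g ` Y" for g x
  proof (cases "x \<in> \<phi> g ` V")
    case True
    then have "x \<notin> \<phi> h ` Y" if "h \<in> carrier G" for h
      using uniq[of g h x] \<open>g \<in> carrier G\<close> \<open>x \<notin> \<phi> g ` Y\<close> YV that by blast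
    with eq[OF \<open>x \<in> topspace X\<close>] show ?thesis by (simp add: P_def)
  qed (simp add: P_def)
  \<comment> \<open>The open sets \<open>g V\<close> and the complement of \<open>g Y\<close> cover
    the space, and on their overlap the two maps agree.\<close>
  have P_cont: "continuous_map X X (P g)" if g: "g \<in> carrier G" for g
  proof (rule pasting_lemma[where I = UNIV and T = "\<lambda>b. if b then \<phi> g ` V else topspace X - \<phi> g ` Y"
        and f = "\<lambda>b. if b then F\<^sub>1 else F\<^sub>0"])
    show "openin X (if b then \<phi> g ` V else topspace X - \<phi> g ` Y)" for b
      using openin_translate[OF g V] closedin_translate[OF g Y] by auto
    show "continuous_map (subtopology X (if b then \<phi> g ` V else topspace X - \<phi> g ` Y)) X (if b then F\<^sub>1 else F\<^sub>0)" for b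
      using F0 F1 by (auto intro: continuous_map_from_subtopology)
    have "F\<^sub>1 x = F\<^sub>0 x" if "x \<in> topspace X" "x \<in> \<phi> g ` V" "x \<notin> \<phi> g ` Y" for x
      using P_eq0[OF g that(1,3)] that(2) by (simp add: P_def)
    then show "(if i then F\<^sub>1 else F\<^sub>0) x = (if j then F\<^sub>1 else F\<^sub>0) x"
      if "i \<in> UNIV" "j \<in> UNIV" "x \<in> topspace X \<inter> (if i then \<phi> g ` V else topspace X - \<phi> g ` Y) \<inter> (if j then \<phi> g ` V else topspace X - \<phi> g ` Y)"
      for i j x
      using that by (auto split: if_splits)
    show "\<exists>j. j \<in> UNIV \<and> x \<in> (if j then \<phi> g ` V else topspace X - \<phi> g ` Y) \<and> P g x = (if j then F\<^sub>1 else F\<^sub>0) x"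
      if "x \<in> topspace X" for x
      using that YV by (intro exI[of _ "x \<in> \<phi> g ` V"]) (auto simp: P_def)
  qed
  have F_in: "F\<^sub>0 x \<in> topspace X" "F\<^sub>1 x \<in> topspace X" if "x \<in> topspace X" for x
    using F0 F1 that by (auto simp: continuous_map_def)
  have P_conj: "P g x = (\<phi> g \<circ> P \<one> \<circ> \<phi> (inv g)) x" if "g \<in> carrier G" "x \<in> topspace X" for g x
  proof -
    have "x \<in> \<phi> g ` V \<longleftrightarrow> \<phi> (inv g) x \<in> \<phi> \<one> ` V"
      using that VX by (simp add: in_translate_iff)
    moreover have "\<phi> g (F (\<phi> (inv g) x)) = F x" if "equivariant F" for F
      using that \<open>g \<in> carrier G\<close> \<open>x \<in> topspace X\<close> unfolding equivariant_def
      by (metis act_in act_inv' inv_closed)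
    ultimately show ?thesis using F0 F1 by (simp add: P_def)
  qed
  obtain k where k: "cohomologous (Suc q) X (pullback (Suc q) (P \<one>) u) (\<lambda>\<sigma>. k * u \<sigma>)"
    using generator_pullback[OF u P_cont[OF one_closed]] .
  obtain l where l: "cohomologous (Suc q) X (pullback (Suc q) F\<^sub>0 u) (\<lambda>\<sigma>. l * u \<sigma>)"
    using generator_pullback[OF u F0(1)] .
  \<comment> \<open>The same \<open>k\<close> serves for every \<open>g\<close>, as
    \<open>P g\<close> is conjugate to \<open>P \<one>\<close>.\<close>
  have Pk: "cohomologous (Suc q) X (pullback (Suc q) (P g) u) (\<lambda>\<sigma>. k * u \<sigma>)" if g: "g \<in> carrier G" for g
  proof -
    have "cohomologous (Suc q) X (pullback (Suc q) (P g) u) (pullback (Suc q) (\<phi> g \<circ> P \<one> \<circ> \<phi> (inv g)) u)"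
      by (rule cohomologous_pullback_cong) (rule P_conj[OF g])
    moreover have "cohomologous (Suc q) X (pullback (Suc q) (\<phi> g \<circ> P \<one> \<circ> \<phi> (inv g)) u) (pullback (Suc q) (P \<one>) u)"
      using g by (intro pullback_conjugate[OF u] continuous_action P_cont) auto
    ultimately show ?thesis using k cohomologous_trans by blast
  qed
  \<comment> \<open>\<delta> measures the failure of the changes to add up. On a simplex in
    \<open>g V\<close> only the summand of \<open>g\<close> survives and cancels the total change;
    on a simplex in \<open>W\<close> below, every difference is zero.\<close>
  define \<delta> where "\<delta> = (\<lambda>\<sigma>. (pullback (Suc q) F\<^sub>1 u \<sigma> - pullback (Suc q) F\<^sub>0 u \<sigma>) -
      (\<Sum>g\<in>carrier G. pullback (Suc q) (P g) u \<sigma> - pullback (Suc q) F\<^sub>0 u \<sigma>))"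
  define W where "W = topspace X - (\<Union>g\<in>carrier G. \<phi> g ` Y)"
  have "cohomologous (Suc q) X \<delta> (\<lambda>_. 0)"
  proof (rule cocycle_vanishing_on_small_simplices[where \<C> = "insert W ((\<lambda>g. \<phi> g ` V) ` carrier G)"])
    show "cocycle (Suc q) X \<delta>"
      unfolding \<delta>_def
      by (intro cocycle_diff cocycle_sum cocycle_pullback[OF cocycle_u] F0 F1 P_cont)
    show "openin X U" if "U \<in> insert W ((\<lambda>g. \<phi> g ` V) ` carrier G)" for U
      using that openin_translate[OF _ V] closedin_translate[OF _ Y] finite_carrier
      by (auto simp: W_def intro!: openin_diff closedin_Union)
    show "topspace X \<subseteq> \<Union> (insert W ((\<lambda>g. \<phi> g ` V) ` carrier G))"
      using YV by (auto simp: W_def)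
    show "\<delta> \<sigma> = 0" if U: "U \<in> insert W ((\<lambda>g. \<phi> g ` V) ` carrier G)"
      and \<sigma>: "singular_simplex (Suc q) (subtopology X U) \<sigma>" for U \<sigma>
    proof (cases "U = W")
      case True
      have "pullback (Suc q) F\<^sub>1 u \<sigma> = pullback (Suc q) F\<^sub>0 u \<sigma>"
        by (rule pullback_cong[OF \<sigma>]) (auto simp: True W_def intro!: eq)
      moreover have "pullback (Suc q) (P g) u \<sigma> = pullback (Suc q) F\<^sub>0 u \<sigma>" if "g \<in> carrier G" for g
        by (rule pullback_cong[OF \<sigma>]) (use that in \<open>auto simp: True W_def intro!: P_eq0\<close>)
      ultimately show ?thesis by (simp add: \<delta>_def)
    next
      case False
      then obtain g where g: "g \<in> carrier G" "U = \<phi> g ` V" using U by blast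
      have "pullback (Suc q) (P g) u \<sigma> = pullback (Suc q) F\<^sub>1 u \<sigma>"
        by (rule pullback_cong[OF \<sigma>]) (simp add: g P_def)
      moreover have "pullback (Suc q) (P h) u \<sigma> = pullback (Suc q) F\<^sub>0 u \<sigma>"
        if "h \<in> carrier G - {g}" for h
      proof (rule pullback_cong[OF \<sigma>])
        fix x assume "x \<in> U"
        then have "x \<notin> \<phi> h ` V" using uniq[OF g(1), of h x] that g by blast
        then show "P h x = F\<^sub>0 x" by (simp add: P_def)
      qed
      ultimately show ?thesis
        using sum.remove[OF finite_carrier g(1), of "\<lambda>h. pullback (Suc q) (P h) u \<sigma> - pullback (Suc q) F\<^sub>0 u \<sigma>"]
        by (simp add: \<delta>_def)
    qed
  qed
  then have "cohomologous (Suc q) X (\<lambda>\<sigma>. pullback (Suc q) F\<^sub>1 u \<sigma> - pullback (Suc q) F\<^sub>0 u \<sigma>)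
      (\<lambda>\<sigma>. \<Sum>g\<in>carrier G. pullback (Suc q) (P g) u \<sigma> - pullback (Suc q) F\<^sub>0 u \<sigma>)"
    unfolding \<delta>_def by (subst cohomologous_iff_diff)
  moreover have "cohomologous (Suc q) X
      (\<lambda>\<sigma>. \<Sum>g\<in>carrier G. pullback (Suc q) (P g) u \<sigma> - pullback (Suc q) F\<^sub>0 u \<sigma>)
      (\<lambda>\<sigma>. \<Sum>g\<in>carrier G. k * u \<sigma> - l * u \<sigma>)"
    by (intro cohomologous_sum cohomologous_diff Pk l)
  ultimately have "cohomologous (Suc q) X (\<lambda>\<sigma>. pullback (Suc q) F\<^sub>1 u \<sigma> - pullback (Suc q) F\<^sub>0 u \<sigma>)
      (\<lambda>\<sigma>. \<Sum>g\<in>carrier G. k * u \<sigma> - l * u \<sigma>)"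
    by (rule cohomologous_trans)
  \<comment> \<open>The sum has \<open>order G\<close> equal terms
    \<open>(k - l) * u\<close>.\<close>
  then show thesis
    by (intro that[of "k - l"]) (simp add: order_def algebra_simps)
qed

text \<open>On \<open>Y\<close>, values are prescribed as \<open>F\<^sub>1\<close> on
  \<open>K\<close> and on the part of \<open>A\<close> in \<open>Y\<close>, and as
  \<open>F\<^sub>0\<close> on \<open>Y - U\<close>; these are extended over \<open>Y\<close>, copied
  to the disjoint translates by equivariance, and completed by \<open>F\<^sub>0\<close> elsewhere.
  The collar \<open>Y - U\<close> makes the pieces fit continuously.\<close>

lemma equivariant_extension:
  assumes F0: "continuous_map X X F\<^sub>0" "equivariant F\<^sub>0"
    and F1: "continuous_map X X F\<^sub>1" "equivariant F\<^sub>1"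
    and A: "closedin X A" "\<And>g. g \<in> carrier G \<Longrightarrow> \<phi> g ` A \<subseteq> A" "\<And>x. x \<in> A \<Longrightarrow> F\<^sub>0 x = F\<^sub>1 x"
    and K: "closedin X K" and U: "openin X U" and Y: "closedin X Y" and KUY: "K \<subseteq> U" "U \<subseteq> Y"
    and disj: "\<And>g. \<lbrakk>g \<in> carrier G; g \<noteq> \<one>\<rbrakk> \<Longrightarrow> \<phi> g ` Y \<inter> Y = {}"
    and ext: "\<And>B a. \<lbrakk>closedin X B; B \<subseteq> Y; continuous_map (subtopology X B) X a\<rbrakk> \<Longrightarrow>
                \<exists>e. continuous_map (subtopology X Y) X e \<and> (\<forall>x\<in>B. e x = a x)"
  obtains F where "continuous_map X X F" "equivariant F" "\<And>x. x \<in> A \<union> K \<Longrightarrow> F x = F\<^sub>1 x"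
    "\<And>x. \<lbrakk>x \<in> topspace X; \<And>g. g \<in> carrier G \<Longrightarrow> x \<notin> \<phi> g ` Y\<rbrakk> \<Longrightarrow> F x = F\<^sub>0 x"
proof -
  have AX: "A \<subseteq> topspace X" and YX: "Y \<subseteq> topspace X"
    using A(1) Y by (simp_all add: closedin_subset)
  have uniq: "g = h" if "g \<in> carrier G" "h \<in> carrier G" "x \<in> \<phi> g ` Y" "x \<in> \<phi> h ` Y" for g h x
    using translates_unique[OF YX disj] that by blast
  define a where "a = (\<lambda>x. if x \<in> K \<union> A then F\<^sub>1 x else F\<^sub>0 x)"
  define B where "B = (Y - U) \<union> (K \<union> Y \<inter> A)"
  have clo: "closedin X (Y - U)" "closedin X (K \<union> Y \<inter> A)"
    using A(1) K U Y by (auto intro: closedin_diff)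
  have contF: "continuous_map (subtopology (subtopology X B) T) X F\<^sub>0"
    "continuous_map (subtopology (subtopology X B) T) X F\<^sub>1" for T
    using F0 F1 by (simp_all add: continuous_map_from_subtopology)
  \<comment> \<open>The two prescriptions are compatible: \<open>K\<close> misses
    \<open>Y - U\<close>, and on \<open>A\<close> both maps agree.\<close>
  have conta: "continuous_map (subtopology X B) X a"
  proof (rule pasting_lemma_closed[where I = UNIV and T = "\<lambda>b. if b then K \<union> Y \<inter> A else Y - U"
        and f = "\<lambda>b. if b then F\<^sub>1 else F\<^sub>0"])
    show "closedin (subtopology X B) (if b then K \<union> Y \<inter> A else Y - U)" for b
      using clo by (cases b) (auto intro!: closedin_subset_topspace simp: B_def)
    have "a x = F\<^sub>1 x" if "x \<in> K \<union> Y \<inter> A" for x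
      using that by (auto simp: a_def)
    moreover have "a x = F\<^sub>0 x" if "x \<in> Y - U" for x
      using that KUY A(3) by (auto simp: a_def)
    ultimately have *: "(if b then F\<^sub>1 else F\<^sub>0) x = a x" if "x \<in> (if b then K \<union> Y \<inter> A else Y - U)" for b x
      using that by (cases b) simp_all
    then show "(if i then F\<^sub>1 else F\<^sub>0) x = (if j then F\<^sub>1 else F\<^sub>0) x"
      if "x \<in> topspace (subtopology X B) \<inter> (if i then K \<union> Y \<inter> A else Y - U) \<inter> (if j then K \<union> Y \<inter> A else Y - U)"
      for i j x
      using that *[of x i] *[of x j] by (cases i; cases j) simp_all
    show "\<exists>j. j \<in> UNIV \<and> x \<in> (if j then K \<union> Y \<inter> A else Y - U) \<and> a x = (if j then F\<^sub>1 else F\<^sub>0) x"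
      if x: "x \<in> topspace (subtopology X B)" for x
    proof -
      obtain b where b: "x \<in> (if b then K \<union> Y \<inter> A else Y - U)"
      proof (cases "x \<in> Y - U")
        case True
        then show thesis by (intro that[of False]) simp
      next
        case False
        then show thesis using x by (intro that[of True]) (auto simp: B_def)
      qed
      then show ?thesis using *[OF b] by (intro exI[of _ b]) simp
    qed
  qed (use contF in auto)
  have "closedin X B" "B \<subseteq> Y"
    using clo KUY by (auto simp: B_def)
  from ext[OF this conta] obtain e where e: "continuous_map (subtopology X Y) X e" "\<And>x. x \<in> B \<Longrightarrow> e x = a x"
    by blast
  have e_A: "e x = F\<^sub>1 x" if "x \<in> Y" "x \<in> K \<union> A" for x
    using e(2)[of x] that KUY by (auto simp: B_def a_def)
  have e_U: "e x = F\<^sub>0 x" if "x \<in> Y - U" for x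
    using e(2)[of x] that KUY A(3) by (auto simp: B_def a_def)
  have eX: "e x \<in> topspace X" if "x \<in> Y" for x
    using continuous_map_image_subset_topspace[OF e(1)] YX that by auto
  \<comment> \<open>The chosen \<open>g\<close> is the only possible one, because the translates of
    \<open>Y\<close> are disjoint.\<close>
  define F where "F = (\<lambda>x. if \<exists>g\<in>carrier G. x \<in> \<phi> g ` Y
     then let g = SOME g. g \<in> carrier G \<and> x \<in> \<phi> g ` Y in \<phi> g (e (\<phi> (inv g) x)) else F\<^sub>0 x)"
  have F_on: "F (\<phi> g y) = \<phi> g (e y)" if "g \<in> carrier G" "y \<in> Y" for g y
  proof -
    have "(SOME h. h \<in> carrier G \<and> \<phi> g y \<in> \<phi> h ` Y) = g"
      using that uniq by (intro some_equality) blast+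
    moreover have "\<exists>h\<in>carrier G. \<phi> g y \<in> \<phi> h ` Y" using that by blast
    moreover have "\<phi> (inv g) (\<phi> g y) = y" using that YX by auto
    ultimately show ?thesis by (simp add: F_def)
  qed
  have F_off: "F x = F\<^sub>0 x" if "\<And>g. g \<in> carrier G \<Longrightarrow> x \<notin> \<phi> g ` Y" for x
    using that by (simp add: F_def)
  have eqv: "F' (\<phi> g x) = \<phi> g (F' x)" if "equivariant F'" "g \<in> carrier G" "x \<in> topspace X" for F' g x
    using that by (simp add: equivariant_def)
  have F_F0: "F x = F\<^sub>0 x" if x: "x \<in> topspace X" "\<And>g. g \<in> carrier G \<Longrightarrow> x \<notin> \<phi> g ` U" for x
  proof (cases "\<exists>g\<in>carrier G. x \<in> \<phi> g ` Y")
    case True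
    then obtain g y where g: "g \<in> carrier G" "y \<in> Y" "x = \<phi> g y" by blast
    then have "y \<in> Y - U" using x(2)[of g] by blast
    with e_U g F_on YX eqv[OF F0(2)] show ?thesis by auto
  qed (use F_off in blast)
  have contF: "continuous_map X X F"
  \<comment> \<open>A finite closed cover: \<open>None\<close> indexes the complement of all
    \<open>g U\<close>, \<open>Some g\<close> the translate \<open>g Y\<close>. They overlap only in
    translates of \<open>Y - U\<close>, where \<open>e\<close> equals
    \<open>F\<^sub>0\<close>.\<close>
  proof (rule pasting_lemma_closed[where I = "insert None (Some ` carrier G)"
        and T = "case_option (topspace X - (\<Union>g\<in>carrier G. \<phi> g ` U)) (\<lambda>g. \<phi> g ` Y)"
        and f = "case_option F\<^sub>0 (\<lambda>g. \<phi> g \<circ> (e \<circ> \<phi> (inv g)))"])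
    let ?T = "case_option (topspace X - (\<Union>g\<in>carrier G. \<phi> g ` U)) (\<lambda>g. \<phi> g ` Y)"
    let ?f = "case_option F\<^sub>0 (\<lambda>g. \<phi> g \<circ> (e \<circ> \<phi> (inv g)))"
    let ?I = "insert None (Some ` carrier G)"
    show "finite ?I" using finite_carrier by simp
    show "closedin X (?T i)" if "i \<in> ?I" for i
      using that closedin_translate[OF _ Y] openin_translate[OF _ U] by (auto intro!: closedin_diff openin_Union)
    show "continuous_map (subtopology X (?T i)) X (?f i)" if i: "i \<in> ?I" for i
    proof (cases i)
      case None
      then show ?thesis using F0 by (simp add: continuous_map_from_subtopology)
    next
      case (Some g)
      then have g: "g \<in> carrier G" using i by blast
      have "continuous_map (subtopology X (\<phi> g ` Y)) (subtopology X Y) (\<phi> (inv g))"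
        using g YX continuous_action[of "inv g"]
        by (auto simp: continuous_map_in_subtopology continuous_map_from_subtopology)
      then have "continuous_map (subtopology X (\<phi> g ` Y)) X (\<phi> g \<circ> (e \<circ> \<phi> (inv g)))"
        by (rule continuous_map_compose[OF continuous_map_compose[OF _ e(1)] continuous_action[OF g]])
      then show ?thesis by (simp add: Some)
    qed
    have *: "?f i x = F x" if i: "i \<in> ?I" and x: "x \<in> topspace X" "x \<in> ?T i" for i x
    proof (cases i)
      case None
      then show ?thesis using F_F0[OF x(1)] x(2) by auto
    next
      case (Some g)
      then obtain y where y: "y \<in> Y" "x = \<phi> g y" "g \<in> carrier G" using i x(2) by auto
      then have "\<phi> (inv g) x = y" using YX by auto
      then show ?thesis using Some F_on y by simp
    qed
    show "?f i x = ?f j x" if "i \<in> ?I" "j \<in> ?I" "x \<in> topspace X \<inter> ?T i \<inter> ?T j" for i j x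
      using *[of i x] *[of j x] that by simp
    show "\<exists>i. i \<in> ?I \<and> x \<in> ?T i \<and> F x = ?f i x" if x: "x \<in> topspace X" for x
    proof -
      obtain i where i: "i \<in> ?I" "x \<in> ?T i"
      proof (cases "\<exists>g\<in>carrier G. x \<in> \<phi> g ` Y")
        case True
        then obtain g where "g \<in> carrier G" "x \<in> \<phi> g ` Y" by blast
        then show thesis by (intro that[of "Some g"]) auto
      next
        case False
        then show thesis using x KUY by (intro that[of None]) auto
      qed
      then show ?thesis using *[OF i(1) x i(2)] by auto
    qed
  qed
  have F_equiv: "F (\<phi> g x) = \<phi> g (F x)" if g: "g \<in> carrier G" and x: "x \<in> topspace X" for g x
  proof (cases "\<exists>h\<in>carrier G. x \<in> \<phi> h ` Y")
    case True
    then obtain h y where h: "h \<in> carrier G" "y \<in> Y" "x = \<phi> h y" by blast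
    have "y \<in> topspace X" using h(2) YX by blast
    then have "\<phi> g x = \<phi> (g \<otimes> h) y" using h g composition_rule by simp
    then show ?thesis using F_on[of "g \<otimes> h" y] F_on[of h y] h g eX composition_rule[of "e y" g h] by simp
  next
    case False
    have "\<phi> g x \<notin> \<phi> h ` Y" if h: "h \<in> carrier G" for h
    proof
      assume "\<phi> g x \<in> \<phi> h ` Y"
      then obtain y where y: "y \<in> Y" "\<phi> g x = \<phi> h y" by blast
      then have "x = \<phi> (inv g) (\<phi> h y)" using act_inv[OF g x] by simp
      also have "\<dots> = \<phi> (inv g \<otimes> h) y"
        using y(1) YX g h by (subst composition_rule) auto
      finally show False using False y(1) g h by blast
    qed
    then show ?thesis using F_off[of "\<phi> g x"] F_off[of x] False eqv[OF F0(2) g x] by auto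
  qed
  have K_translate: "x \<in> \<phi> \<one> ` Y" if "x \<in> K" for x
  proof -
    have "x \<in> Y" "x \<in> topspace X" using that KUY YX by blast+
    then show ?thesis using in_translate_iff[OF one_closed YX] by simp
  qed
  show thesis
  proof (rule that[OF contF])
    show "equivariant F" using F_equiv by (simp add: equivariant_def)
    show "F x = F\<^sub>0 x" if "x \<in> topspace X" "\<And>g. g \<in> carrier G \<Longrightarrow> x \<notin> \<phi> g ` Y" for x
      using F_off that(2) by blast
    show "F x = F\<^sub>1 x" if "x \<in> A \<union> K" for x
    proof (cases "\<exists>g\<in>carrier G. x \<in> \<phi> g ` Y")
      case True
      then obtain g y where g: "g \<in> carrier G" "y \<in> Y" "x = \<phi> g y" by blast
      have yX: "y \<in> topspace X" using g(2) YX by blast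
      \<comment> \<open>If \<open>x\<close> is in \<open>A\<close>, invariance of \<open>A\<close>
        returns \<open>y\<close> to \<open>A\<close>. If \<open>x\<close> is in \<open>K\<close>, it
        lies in the translate of \<open>Y\<close> by \<open>\<one>\<close>, which forces
        \<open>g = \<one>\<close> and \<open>y = x\<close>.\<close>
      have "y \<in> K \<union> A"
      proof (cases "x \<in> A")
        case True
        have "y = \<phi> (inv g) x" using g yX by simp
        then show ?thesis using A(2)[of "inv g"] g(1) True by blast
      next
        case False
        then have "x \<in> K" using that by blast
        moreover from this have "x \<in> \<phi> \<one> ` Y" by (rule K_translate)
        ultimately have "g = \<one>" using uniq[of g \<one> x] g by blast
        then show ?thesis using g yX \<open>x \<in> K\<close> by simp
      qed
      then show ?thesis using e_A[OF g(2)] F_on g eqv[OF F1(2) g(1) yX] by simp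
    next
      case False
      have "x \<in> A" using False that K_translate one_closed by blast
      then show ?thesis using F_off[of x] False A(3) by auto
    qed
  qed
qed

text \<open>The last clause, extendability of maps into \<open>X\<close> from closed subsets of \<open>Y\<close>, is where the
  dimension of the sphere enters.\<close>

definition small_piece :: "'a set \<Rightarrow> bool" where
  "small_piece K \<longleftrightarrow> closedin X K \<and>
     (\<exists>U Y V. openin X U \<and> closedin X Y \<and> openin X V \<and> K \<subseteq> U \<and> U \<subseteq> Y \<and> Y \<subseteq> V \<and>
        (\<forall>g\<in>carrier G. g \<noteq> \<one> \<longrightarrow> \<phi> g ` V \<inter> V = {}) \<and>
        (\<forall>B a. closedin X B \<longrightarrow> B \<subseteq> Y \<longrightarrow> continuous_map (subtopology X B) X a \<longrightarrow>
           (\<exists>e. continuous_map (subtopology X Y) X e \<and> (\<forall>x\<in>B. e x = a x))))"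

text \<open>Induction over the finite cover turns \<open>F\<^sub>0\<close> into
  \<open>F\<^sub>1\<close> one piece at a time. Each piece costs a multiple of
  \<open>order G\<close>, and these multiples add up.\<close>

lemma pullback_equivariant_diff:
  assumes u: "cohom_generator (Suc q) X u"
    and F0: "continuous_map X X F\<^sub>0" "equivariant F\<^sub>0"
    and F1: "continuous_map X X F\<^sub>1" "equivariant F\<^sub>1"
    and fin: "finite \<K>" and small: "\<And>K. K \<in> \<K> \<Longrightarrow> small_piece K" and cov: "topspace X \<subseteq> \<Union>\<K>"
  obtains m where "cohomologous (Suc q) X
      (\<lambda>\<sigma>. pullback (Suc q) F\<^sub>1 u \<sigma> - pullback (Suc q) F\<^sub>0 u \<sigma>) (\<lambda>\<sigma>. int (order G) * m * u \<sigma>)"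
proof -
  have "\<exists>F m. continuous_map X X F \<and> equivariant F \<and> (\<forall>x\<in>\<Union>\<K>. F x = F\<^sub>1 x) \<and>
      cohomologous (Suc q) X (\<lambda>\<sigma>. pullback (Suc q) F u \<sigma> - pullback (Suc q) F\<^sub>0 u \<sigma>)
        (\<lambda>\<sigma>. int (order G) * m * u \<sigma>)"
    using fin small
  proof (induction \<K>)
    case empty
    show ?case
      by (rule exI[of _ "F\<^sub>0"], rule exI[of _ 0]) (simp add: F0 cohomologous_refl)
  next
    case (insert K \<K>)
    then obtain F m where F: "continuous_map X X F" "equivariant F" "\<And>x. x \<in> \<Union>\<K> \<Longrightarrow> F x = F\<^sub>1 x"
      and m: "cohomologous (Suc q) X (\<lambda>\<sigma>. pullback (Suc q) F u \<sigma> - pullback (Suc q) F\<^sub>0 u \<sigma>)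
        (\<lambda>\<sigma>. int (order G) * m * u \<sigma>)"
      by (metis insert_iff)
    have "small_piece K" using insert.prems by blast
    then obtain U Y V where K: "closedin X K" and U: "openin X U" and Y: "closedin X Y" and V: "openin X V"
      and KUYV: "K \<subseteq> U" "U \<subseteq> Y" "Y \<subseteq> V"
      and disj: "\<And>g. \<lbrakk>g \<in> carrier G; g \<noteq> \<one>\<rbrakk> \<Longrightarrow> \<phi> g ` V \<inter> V = {}"
      and ext: "\<And>B a. \<lbrakk>closedin X B; B \<subseteq> Y; continuous_map (subtopology X B) X a\<rbrakk> \<Longrightarrow>
                \<exists>e. continuous_map (subtopology X Y) X e \<and> (\<forall>x\<in>B. e x = a x)"
      unfolding small_piece_def by metis
    have clK: "closedin X (\<Union>\<K>)"
      using insert by (auto simp: small_piece_def intro!: closedin_Union)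
    then have KX: "\<Union>\<K> \<subseteq> topspace X" by (rule closedin_subset)
    \<comment> \<open>The saturation of the pieces already treated. Agreement with
      \<open>F\<^sub>1\<close> spreads to it by equivariance, and finiteness of the group keeps it
      closed.\<close>
    define A where "A = (\<Union>g\<in>carrier G. \<phi> g ` \<Union>\<K>)"
    have A: "closedin X A"
      unfolding A_def using finite_carrier closedin_translate[OF _ clK] by (auto intro!: closedin_Union)
    have A_inv: "\<phi> g ` A \<subseteq> A" if g: "g \<in> carrier G" for g
    proof clarify
      fix x assume "x \<in> A"
      then obtain h y where h: "h \<in> carrier G" "y \<in> \<Union>\<K>" "x = \<phi> h y" unfolding A_def by blast
      then have "\<phi> g x = \<phi> (g \<otimes> h) y" using composition_rule[of y g h] g KX by auto
      then show "\<phi> g x \<in> A" using h g unfolding A_def by blast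
    qed
    have A_eq: "F x = F\<^sub>1 x" if x: "x \<in> A" for x
    proof -
      obtain h y where h: "h \<in> carrier G" "y \<in> \<Union>\<K>" "x = \<phi> h y" using x unfolding A_def by blast
      then have "y \<in> topspace X" using KX by blast
      then have "F x = \<phi> h (F y)" "F\<^sub>1 x = \<phi> h (F\<^sub>1 y)"
        using F(2) F1(2) h(1,3) by (simp_all add: equivariant_def)
      then show ?thesis using F(3)[OF h(2)] by simp
    qed
    have "\<Union>\<K> \<subseteq> A"
    proof
      fix x assume "x \<in> \<Union>\<K>"
      then have "x = \<phi> \<one> x" using KX by auto
      with \<open>x \<in> \<Union>\<K>\<close> show "x \<in> A" unfolding A_def by blast
    qed
    have disjY: "\<phi> g ` Y \<inter> Y = {}" if "g \<in> carrier G" "g \<noteq> \<one>" for g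
      using disj[OF that] KUYV by blast
    obtain F' where F': "continuous_map X X F'" "equivariant F'" "\<And>x. x \<in> A \<union> K \<Longrightarrow> F' x = F\<^sub>1 x"
      "\<And>x. \<lbrakk>x \<in> topspace X; \<And>g. g \<in> carrier G \<Longrightarrow> x \<notin> \<phi> g ` Y\<rbrakk> \<Longrightarrow> F' x = F x"
      using equivariant_extension[OF F(1,2) F1 A A_inv A_eq K U Y KUYV(1,2) disjY ext] by blast
    obtain m' where m': "cohomologous (Suc q) X
      (\<lambda>\<sigma>. pullback (Suc q) F' u \<sigma> - pullback (Suc q) F u \<sigma>) (\<lambda>\<sigma>. int (order G) * m' * u \<sigma>)"
      using pullback_change_on_orbit[OF u F(1,2) F'(1,2) Y V KUYV(3) disj F'(4)] by blast
    have "cohomologous (Suc q) X (\<lambda>\<sigma>. pullback (Suc q) F' u \<sigma> - pullback (Suc q) F\<^sub>0 u \<sigma>)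
        (\<lambda>\<sigma>. int (order G) * (m + m') * u \<sigma>)"
      using cohomologous_add[OF m m'] by (simp add: algebra_simps)
    moreover have "\<forall>x\<in>\<Union>(insert K \<K>). F' x = F\<^sub>1 x"
      using F'(3) \<open>\<Union>\<K> \<subseteq> A\<close> by blast
    ultimately show ?case using F'(1,2) by blast
  qed
  then obtain F m where F: "\<forall>x\<in>\<Union>\<K>. F x = F\<^sub>1 x"
    and m: "cohomologous (Suc q) X (\<lambda>\<sigma>. pullback (Suc q) F u \<sigma> - pullback (Suc q) F\<^sub>0 u \<sigma>)
        (\<lambda>\<sigma>. int (order G) * m * u \<sigma>)"
    by blast
  \<comment> \<open>The pieces cover the space, so the final map of the induction is
    \<open>F\<^sub>1\<close> on all of it.\<close>
  have "cohomologous (Suc q) X (pullback (Suc q) F\<^sub>1 u) (pullback (Suc q) F u)"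
    by (rule cohomologous_pullback_cong) (use F cov in auto)
  from cohomologous_trans[OF cohomologous_diff[OF this cohomologous_refl] m] show thesis
    by (rule that)
qed

end

subsection \<open>Free actions on the sphere\<close>

text \<open>Removing \<open>b\<close> leaves a copy of a hyperplane, so \<open>Y\<close> embeds in a
  polytope of dimension below that of the unit ball. Maps from closed subsets of such a polytope to
  the boundary of the ball extend.\<close>

lemma extend_map_from_punctured_sphere:
  fixes f :: "'e::euclidean_space \<Rightarrow> 'e"
  assumes A: "closed A" "A \<subseteq> Y" and Y: "compact Y" "Y \<subseteq> sphere 0 1 - {b}" and b: "b \<in> sphere 0 1"
    and f: "continuous_on A f" "f \<in> A \<rightarrow> sphere 0 1"
  obtains g where "continuous_on Y g" "g \<in> Y \<rightarrow> sphere 0 1" "\<And>x. x \<in> A \<Longrightarrow> g x = f x"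
proof -
  have "b \<noteq> 0" using b by auto
  define H where "H = {x. b \<bullet> x = 0}"
  have "(sphere 0 1 - {b}) homeomorphic H"
    unfolding H_def using b \<open>b \<noteq> 0\<close> by (intro homeomorphic_punctured_sphere_hyperplane) auto
  then obtain h k where hk: "homeomorphism (sphere 0 1 - {b}) H h k"
    by (auto simp: homeomorphic_def)
  have conth: "continuous_on Y h"
    using hk Y(2) continuous_on_subset homeomorphism_cont1 by blast
  have cpt: "compact (h ` Y)" using compact_continuous_image[OF conth Y(1)] .
  have kh: "k (h x) = x" if "x \<in> Y" for x
    using homeomorphism_apply1[OF hk] that Y(2) by blast
  have hYH: "h ` Y \<subseteq> H" using hk Y(2) by (auto simp: homeomorphism_def)
  have "compact A" using A Y(1) compact_Int_closed[of Y A] by (simp add: Int_absorb1)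
  then have cptA: "compact (h ` A)"
    using A conth compact_continuous_image continuous_on_subset by blast
  obtain a where a: "h ` Y \<subseteq> cbox (-a) a"
    using bounded_subset_cbox_symmetric[OF compact_imp_bounded[OF cpt]] .
  \<comment> \<open>A box large enough to contain the image of \<open>Y\<close>, cut by the
    hyperplane; the cell complex used below is the single cell \<open>C\<close>.\<close>
  define C where "C = cbox (-a) a \<inter> H"
  have poly: "polytope C"
    by (simp add: C_def H_def polytope_Int_polyhedron polytope_interval polyhedron_hyperplane)
  have affC: "aff_dim C < aff_dim (cball (0::'e) 1)"
  proof -
    have "aff_dim C \<le> aff_dim H" by (simp add: C_def aff_dim_subset)
    also have "aff_dim H = DIM('e) - 1" using \<open>b \<noteq> 0\<close> by (simp add: H_def)
    finally show ?thesis by (simp add: aff_dim_cball)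
  qed
  have contk: "continuous_on (h ` A) (f \<circ> k)"
  proof (rule continuous_on_compose)
    show "continuous_on (h ` A) k"
      using hk hYH A(2) by (meson continuous_on_subset homeomorphism_cont2 image_mono order_trans)
    have "k ` h ` A = A" using kh A(2) by force
    then show "continuous_on (k ` h ` A) f" using f(1) by simp
  qed
  obtain g where g: "continuous_on (\<Union>{C}) g" "g \<in> \<Union>{C} \<rightarrow> rel_frontier (cball (0::'e) 1)"
    "\<And>x. x \<in> h ` A \<Longrightarrow> g x = (f \<circ> k) x"
  proof (rule extend_map_cell_complex_to_sphere[of "{C}" "h ` A" "cball (0::'e) 1" "f \<circ> k"])
    show "h ` A \<subseteq> \<Union>{C}" using A(2) a hYH by (auto simp: C_def)
    show "closed (h ` A)" using cptA compact_imp_closed by blast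
    show "(f \<circ> k) \<in> h ` A \<rightarrow> rel_frontier (cball 0 1)"
      using f(2) kh A(2) by (auto simp: Pi_iff subset_iff)
    show "\<And>X Y. \<lbrakk>X \<in> {C}; Y \<in> {C}\<rbrakk> \<Longrightarrow> X \<inter> Y face_of X"
      using poly by (simp add: face_of_refl polytope_imp_convex)
  qed (use poly affC contk in auto)
  have hC: "h ` Y \<subseteq> C" using a hYH by (simp add: C_def)
  show thesis
  proof
    show "continuous_on Y (g \<circ> h)"
      using conth g(1) hC by (intro continuous_on_compose) (auto intro: continuous_on_subset)
    show "g \<circ> h \<in> Y \<rightarrow> sphere 0 1" using g(2) hC by (fastforce simp: Pi_iff)
    show "(g \<circ> h) x = f x" if "x \<in> A" for x
      using g(3)[of "h x"] kh that A(2) by auto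
  qed
qed

text \<open>By freeness and continuity, each of the finitely many nontrivial elements moves a
  neighbourhood of \<open>x\<close> off itself. Concentric balls of radii r, 2r and 3r then give the
  nested sets of \<open>small_piece\<close>.\<close>

lemma free_sphere_action_small_piece:
  fixes \<phi> :: "'g \<Rightarrow> 'e::euclidean_space \<Rightarrow> 'e"
  assumes "finite_continuous_action G (top_of_set (sphere 0 1)) \<phi>"
    and free: "\<And>g x. \<lbrakk>g \<in> carrier G; x \<in> sphere 0 1; \<phi> g x = x\<rbrakk> \<Longrightarrow> g = \<one>\<^bsub>G\<^esub>"
    and x: "x \<in> sphere 0 1"
  obtains r where "0 < r"
    "finite_continuous_action.small_piece G (top_of_set (sphere 0 1)) \<phi> (cball x r \<inter> sphere 0 1)"
proof -
  interpret finite_continuous_action G "top_of_set (sphere 0 1)" \<phi> by fact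
  let ?S = "sphere (0::'e) 1"
  have "\<exists>e>0. \<forall>y\<in>?S. dist x y < e \<longrightarrow> \<not> dist x (\<phi> g y) < e" if g: "g \<in> carrier G" "g \<noteq> \<one>\<^bsub>G\<^esub>" for g
  proof -
    \<comment> \<open>Half the displacement of \<open>x\<close>: a point near \<open>x\<close> whose
      image is also near \<open>x\<close> would make the displacement less than
      \<open>d + d\<close>.\<close>
    define d where "d = dist x (\<phi> g x) / 2"
    have "d > 0" using free[OF g(1) x] g(2) by (auto simp: d_def)
    have "continuous_on ?S (\<phi> g)" using continuous_action[OF g(1)] by (simp add: continuous_map_in_subtopology)
    then obtain e where e: "e > 0" "\<And>y. \<lbrakk>y \<in> ?S; dist y x < e\<rbrakk> \<Longrightarrow> dist (\<phi> g y) (\<phi> g x) < d"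
      using \<open>d > 0\<close> x unfolding continuous_on_iff by metis
    have "\<not> dist x (\<phi> g y) < min e d" if "y \<in> ?S" "dist x y < min e d" for y
    proof
      assume "dist x (\<phi> g y) < min e d"
      then have "dist x (\<phi> g x) < d + d"
        using e(2)[of y] that by (intro dist_triangle_less_add[of x "\<phi> g y" d "\<phi> g x" d]) (auto simp: dist_commute)
      then show False by (simp add: d_def)
    qed
    then show ?thesis using \<open>d > 0\<close> \<open>e > 0\<close> by (intro exI[of _ "min e d"]) auto
  qed
  then obtain e where e: "\<And>g. \<lbrakk>g \<in> carrier G; g \<noteq> \<one>\<^bsub>G\<^esub>\<rbrakk> \<Longrightarrow> e g > 0"
    "\<And>g y. \<lbrakk>g \<in> carrier G; g \<noteq> \<one>\<^bsub>G\<^esub>; y \<in> ?S; dist x y < e g\<rbrakk> \<Longrightarrow> \<not> dist x (\<phi> g y) < e g"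
    by metis
  \<comment> \<open>The inserted 1 keeps the set nonempty when the group is trivial and gives 3r
    \<le> 1. Dividing by 3 leaves room for the three balls.\<close>
  define r where "r = Min (insert 1 (e ` (carrier G - {\<one>\<^bsub>G\<^esub>}))) / 3"
  have fin: "finite (insert 1 (e ` (carrier G - {\<one>\<^bsub>G\<^esub>})))" using finite_carrier by simp
  have r: "r > 0" "3 * r \<le> 1" and re: "\<And>g. \<lbrakk>g \<in> carrier G; g \<noteq> \<one>\<^bsub>G\<^esub>\<rbrakk> \<Longrightarrow> 3 * r \<le> e g"
    using e(1) fin by (auto simp: r_def intro: Min_le)
  define U Y V where "U = ball x (2 * r) \<inter> ?S" and "Y = cball x (2 * r) \<inter> ?S" and "V = ball x (3 * r) \<inter> ?S"
  \<comment> \<open>The antipode, at distance 2 > 2r from \<open>x\<close>, is the puncture used in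
    the extension lemma.\<close>
  have "- x \<notin> Y"
  proof -
    have "dist x (- x) = 2" using x by (simp add: dist_norm flip: scaleR_2)
    then show ?thesis using r by (simp add: Y_def)
  qed
  have ext: "\<exists>f. continuous_map (subtopology (top_of_set ?S) Y) (top_of_set ?S) f \<and> (\<forall>x\<in>B. f x = a x)"
    if B: "closedin (top_of_set ?S) B" "B \<subseteq> Y"
      and a: "continuous_map (subtopology (top_of_set ?S) B) (top_of_set ?S) a" for B a
  proof -
    have YS: "?S \<inter> Y = Y" "?S \<inter> B = B" using B by (auto simp: Y_def)
    have "closed B" using closedin_closed_trans[OF B(1)] by simp
    moreover have "compact Y" unfolding Y_def by (intro compact_Int_closed) auto
    moreover have "Y \<subseteq> ?S - {- x}" using \<open>- x \<notin> Y\<close> by (auto simp: Y_def)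
    moreover have "continuous_on B a" "a \<in> B \<rightarrow> ?S"
      using a by (auto simp: subtopology_subtopology YS continuous_map_in_subtopology)
    moreover have "- x \<in> ?S" using x by simp
    ultimately obtain f where "continuous_on Y f" "f \<in> Y \<rightarrow> ?S" "\<And>x. x \<in> B \<Longrightarrow> f x = a x"
      using B(2) extend_map_from_punctured_sphere[of B Y "- x" a] by metis
    then show ?thesis
      by (intro exI[of _ f]) (auto simp: subtopology_subtopology YS continuous_map_in_subtopology)
  qed
  have closed: "closedin (top_of_set ?S) (cball x s \<inter> ?S)" for s
    by (subst Int_commute) (simp add: closedin_closed_Int)
  have "small_piece (cball x r \<inter> ?S)"
    unfolding small_piece_def
  proof (rule conjI[OF closed exI[of _ U, OF exI[of _ Y, OF exI[of _ V]]]], intro conjI ballI allI impI)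
    show "closedin (top_of_set ?S) Y"
      unfolding Y_def by (rule closed)
    show "openin (top_of_set ?S) U" "openin (top_of_set ?S) V"
      by (simp_all add: U_def V_def Int_commute[of _ ?S] openin_open_Int)
    show "cball x r \<inter> ?S \<subseteq> U" "U \<subseteq> Y" "Y \<subseteq> V" using r by (auto simp: U_def Y_def V_def)
    show "\<phi> g ` V \<inter> V = {}" if g: "g \<in> carrier G" "g \<noteq> \<one>\<^bsub>G\<^esub>" for g
      using e(2)[OF g] re[OF g] by (fastforce simp: V_def)
  qed (use ext in auto)
  with r(1) show thesis by (rule that)
qed

text \<open>The identity is equivariant and pulls \<open>u\<close> back to \<open>u\<close>, so it
  serves as starting map; compactness reduces the small pieces to finitely many.\<close>

lemma equivariant_sphere_map_degree:
  fixes \<phi> :: "'g \<Rightarrow> 'e::euclidean_space \<Rightarrow> 'e"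
  assumes act: "finite_continuous_action G (top_of_set (sphere 0 1)) \<phi>"
    and free: "\<And>g x. \<lbrakk>g \<in> carrier G; x \<in> sphere 0 1; \<phi> g x = x\<rbrakk> \<Longrightarrow> g = \<one>\<^bsub>G\<^esub>"
    and u: "cohom_generator (Suc q) (top_of_set (sphere 0 1)) u"
    and F: "continuous_map (top_of_set (sphere 0 1)) (top_of_set (sphere 0 1)) F"
      "\<And>g x. \<lbrakk>g \<in> carrier G; x \<in> sphere 0 1\<rbrakk> \<Longrightarrow> F (\<phi> g x) = \<phi> g (F x)"
  obtains k where "k mod int (order G) = 1 mod int (order G)"
    "cohomologous (Suc q) (top_of_set (sphere 0 1)) (pullback (Suc q) F u) (\<lambda>\<sigma>. k * u \<sigma>)"
proof -
  let ?S = "sphere (0::'e) 1"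
  interpret finite_continuous_action G "top_of_set ?S" \<phi> by fact
  obtain r where r: "\<And>x. x \<in> ?S \<Longrightarrow> 0 < r x" "\<And>x. x \<in> ?S \<Longrightarrow> small_piece (cball x (r x) \<inter> ?S)"
  proof -
    have "\<exists>r>0. small_piece (cball x r \<inter> ?S)" if "x \<in> ?S" for x
      using free_sphere_action_small_piece[OF act _ that] free by blast
    then obtain r where "\<forall>x\<in>?S. r x > 0 \<and> small_piece (cball x (r x) \<inter> ?S)"
      by metis
    with that show thesis by blast
  qed
  obtain C where C: "C \<subseteq> ?S" "finite C" "?S \<subseteq> (\<Union>x\<in>C. ball x (r x))"
  proof (rule compactE_image[of ?S ?S "\<lambda>x. ball x (r x)"])
    show "?S \<subseteq> (\<Union>x\<in>?S. ball x (r x))" using r(1) by force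
  qed auto
  have cov: "topspace (top_of_set ?S) \<subseteq> \<Union>((\<lambda>x. cball x (r x) \<inter> ?S) ` C)"
  proof
    fix y assume "y \<in> topspace (top_of_set ?S)"
    then obtain x where "x \<in> C" "y \<in> ball x (r x)" "y \<in> ?S" using C(3) by auto
    then show "y \<in> \<Union>((\<lambda>x. cball x (r x) \<inter> ?S) ` C)" using ball_subset_cball by blast
  qed
  obtain m where m: "cohomologous (Suc q) (top_of_set ?S)
      (\<lambda>\<sigma>. pullback (Suc q) F u \<sigma> - pullback (Suc q) id u \<sigma>) (\<lambda>\<sigma>. int (order G) * m * u \<sigma>)"
  proof (rule pullback_equivariant_diff[OF u, of id F])
    show "equivariant F" using F(2) by (simp add: equivariant_def)
    show "small_piece K" if "K \<in> (\<lambda>x. cball x (r x) \<inter> ?S) ` C" for K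
      using that r(2) C(1) by blast
  qed (use F(1) C(2) cov in \<open>auto simp: equivariant_def\<close>)
  have "cohomologous (Suc q) (top_of_set ?S) (pullback (Suc q) id u) u"
    by (rule cohomologous_pullback_id) simp
  from cohomologous_add[OF m this]
  have "cohomologous (Suc q) (top_of_set ?S) (pullback (Suc q) F u) (\<lambda>\<sigma>. (1 + int (order G) * m) * u \<sigma>)"
    by (simp add: algebra_simps)
  then show thesis by (intro that[of "1 + int (order G) * m"]) auto
qed

section \<open>Zeros of maps that are equivariant on the sphere\<close>

theorem theorem5p5:
  fixes G :: "('g, 'm) monoid_scheme"
    and \<phi> :: "'g \<Rightarrow> 'e::euclidean_space \<Rightarrow> 'e"
    and X :: "'a topology"
    and j :: "'e \<Rightarrow> 'a"
    and f :: "'a \<Rightarrow> 'e"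
  assumes grp: "group G" and fin: "finite (carrier G)"
    and dim: "DIM('e) \<ge> 2"
    and act: "group_action G (sphere 0 1) \<phi>"
    and act_cont: "\<forall>g\<in>carrier G. continuous_on (sphere 0 1) (\<phi> g)"
    and act_free: "\<forall>g\<in>carrier G. \<forall>x\<in>sphere 0 1. \<phi> g x = x \<longrightarrow> g = \<one>\<^bsub>G\<^esub>"
    and j_cont: "continuous_map (top_of_set (sphere (0::'e) 1)) X j"
    and coh: "\<exists>u. cohom_generator (DIM('e) - 1) (top_of_set (sphere (0::'e) 1)) u \<and>
              \<not> (\<exists>z k. cocycle (DIM('e) - 1) X z \<and>
                        k mod int (order G) = 1 mod int (order G) \<and>
                        cohomologous (DIM('e) - 1) (top_of_set (sphere (0::'e) 1))
                           (pullback (DIM('e) - 1) j z) (\<lambda>\<sigma>. k * u \<sigma>))"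
    and f_cont: "continuous_map X euclidean f"
    and equiv: "\<forall>g\<in>carrier G. \<forall>x\<in>sphere 0 1. f (j (\<phi> g x)) = radial_ext \<phi> g (f (j x))"
  shows "0 \<in> f ` topspace X"
proof (rule ccontr)
  assume "0 \<notin> f ` topspace X"
  then have nz: "f x \<noteq> 0" if "x \<in> topspace X" for x using that by force
  let ?S = "top_of_set (sphere (0::'e) 1)"
  \<comment> \<open>Dimension at least 2 puts the cohomology in positive degree, where being
    cohomologous means differing by a coboundary.\<close>
  obtain q where q: "DIM('e) - 1 = Suc q" using dim by (cases "DIM('e) - 1") auto
  from coh obtain u where u: "cohom_generator (Suc q) ?S u"
    and no: "\<And>z k. \<lbrakk>cocycle (Suc q) X z; k mod int (order G) = 1 mod int (order G)\<rbrakk> \<Longrightarrow>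
        \<not> cohomologous (Suc q) ?S (pullback (Suc q) j z) (\<lambda>\<sigma>. k * u \<sigma>)"
    unfolding q by blast
  interpret group_action G "sphere 0 1" \<phi> by fact
  have act_S: "\<phi> g x \<in> sphere 0 1" if "g \<in> carrier G" "x \<in> sphere 0 1" for g x
    using element_image[OF that refl] .
  have "finite_continuous_action G ?S \<phi>"
    using act fin act_cont act_S
    by (simp add: finite_continuous_action_def finite_continuous_action_axioms_def
        continuous_map_in_subtopology Pi_iff)
  define h where "h = (\<lambda>x. f x /\<^sub>R norm (f x))"
  have h: "continuous_map X ?S h"
  proof -
    have "continuous_map X (top_of_set (- {0})) f"
      using f_cont nz by (auto simp: continuous_map_in_subtopology)
    moreover have "continuous_map (top_of_set (- {0})) ?S (\<lambda>y. y /\<^sub>R norm y)"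
      by (auto simp: continuous_map_in_subtopology intro!: continuous_intros)
    ultimately show ?thesis
      using continuous_map_compose[of X "top_of_set (- {0})" f ?S "\<lambda>y. y /\<^sub>R norm y"]
      by (simp add: h_def o_def)
  qed
  have jX: "j x \<in> topspace X" if "x \<in> sphere 0 1" for x
    using j_cont that by (auto simp: continuous_map_def)
  \<comment> \<open>The radial extension preserves norms and acts by \<phi> on directions, so
    normalising turns equivariance of \<open>f \<circ> j\<close> into equivariance for
    \<phi>.\<close>
  have hj: "(h \<circ> j) (\<phi> g x) = \<phi> g ((h \<circ> j) x)" if g: "g \<in> carrier G" and x: "x \<in> sphere 0 1" for g x
  proof -
    have n: "f (j x) \<noteq> 0" using nz jX[OF x] by blast
    then have "h (j x) \<in> sphere 0 1" by (simp add: h_def)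
    then have "norm (\<phi> g (h (j x))) = 1" using act_S[OF g] by simp
    moreover have "f (j (\<phi> g x)) = norm (f (j x)) *\<^sub>R \<phi> g (h (j x))"
      using equiv g x n by (simp add: radial_ext_def h_def)
    ultimately show ?thesis using n by (simp add: h_def[of])
  qed
  obtain k where "k mod int (order G) = 1 mod int (order G)"
    "cohomologous (Suc q) ?S (pullback (Suc q) (h \<circ> j) u) (\<lambda>\<sigma>. k * u \<sigma>)"
  proof (rule equivariant_sphere_map_degree[OF \<open>finite_continuous_action G ?S \<phi>\<close> _ u, of "h \<circ> j"])
    show "continuous_map ?S ?S (h \<circ> j)" using continuous_map_compose[OF j_cont h] .
  qed (use act_free hj in auto)
  \<comment> \<open>The forbidden class on \<open>X\<close> is the pullback of \<open>u\<close>
    along \<open>h\<close>: pulling it back further along \<open>j\<close> gives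
    \<open>k * u\<close> up to a coboundary, with \<open>k\<close> congruent to 1.\<close>
  moreover have "cocycle (Suc q) X (pullback (Suc q) h u)"
    using u by (intro cocycle_pullback[OF _ h]) (simp add: cohom_generator_def)
  ultimately show False using no[of "pullback (Suc q) h u" k] by (simp add: pullback_comp)
qed

end
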